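(* Let $G=(V,E)$ be a graph on $n$ vertices with intersection number $m$. Then the algorithm FIND\_MAX-CLIQUE described below, on input $G$, finds a maximum clique of $G$ in $O\!\left(2^{2^m+O(m)} + n^2\min\{2^m,n\}\right)$ time steps.
   Context: The intersection number of a graph $G$ is the smallest number of cliques of $G$ needed to cover all edges of $G$. For $v\in V$, $N_G(v)$ is the neighbor set of $v$, and $v\leftrightarrow_G u$ means $N_G(v)\cup\{v\}=N_G(u)\cup\{u\}$ (an equivalence relation whose classes are called closed neighborhoods). For a partition $\mathcal C'$ of $V$ and $v\in V$, $\mathcal C'[v]$ denotes the part of $\mathcal C'$ containing $v$. Algorithm FIND\_MAX-CLIQUE on input $G$: (1) set $U=V$, $\mathcal C'=\emptyset$; (2)–(5) while $U\neq\emptyset$: pick $v\in U$, let $C'=\{u\in U: u\leftrightarrow_G v\}$, add $C'$ to $\mathcal C'$, and set $U=U\setminus C'$; (6) let $G'$ be an induced subgraph of $G$ containing exactly one vertex from each set $C'\in\mathcal C'$; (7) by exhaustive search over subsets of vertices of $G'$, find a clique $S$ of $G'$ maximizing $|\bigcup_{v'\in S}\mathcal C'[v']|$; (8) output $Q=\bigcup_{v'\in S}\mathcal C'[v']$.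
   Formalization: With n isolated vertices (m=0) a search over all subsets of G' takes 2^n steps, so the bound fails; it is proved for all graphs if step (7) skips supersets of non-cliques, and for the literal search only if G has no isolated vertex. *)

theory Defs
  imports Main "HOL-Library.Monad_Syntax"
begin

section \<open>Graphs, cliques and the intersection number\<close>

definition simple_graph :: "'a set \<Rightarrow> 'a set set \<Rightarrow> bool" where
  "simple_graph V E \<longleftrightarrow> finite V \<and> (\<forall>e\<in>E. e \<subseteq> V \<and> card e = 2)"

definition clique :: "'a set \<Rightarrow> 'a set set \<Rightarrow> 'a set \<Rightarrow> bool" where
  "clique V E K \<longleftrightarrow> K \<subseteq> V \<and> (\<forall>u\<in>K. \<forall>v\<in>K. u \<noteq> v \<longrightarrow> {u, v} \<in> E)"

definition maximum_clique :: "'a set \<Rightarrow> 'a set set \<Rightarrow> 'a set \<Rightarrow> bool" where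
  "maximum_clique V E Q \<longleftrightarrow> clique V E Q \<and> (\<forall>K. clique V E K \<longrightarrow> card K \<le> card Q)"

definition edge_clique_cover :: "'a set \<Rightarrow> 'a set set \<Rightarrow> 'a set set \<Rightarrow> bool" where
  "edge_clique_cover V E \<K> \<longleftrightarrow>
     finite \<K> \<and> (\<forall>K\<in>\<K>. clique V E K) \<and> (\<forall>e\<in>E. \<exists>K\<in>\<K>. e \<subseteq> K)"

definition intersection_number :: "'a set \<Rightarrow> 'a set set \<Rightarrow> nat" where
  "intersection_number V E = (LEAST k. \<exists>\<K>. edge_clique_cover V E \<K> \<and> card \<K> = k)"

definition neighbors :: "'a set \<Rightarrow> 'a set set \<Rightarrow> 'a \<Rightarrow> 'a set" where
  "neighbors V E v = {u \<in> V. {u, v} \<in> E}"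

definition twins :: "'a set \<Rightarrow> 'a set set \<Rightarrow> 'a \<Rightarrow> 'a \<Rightarrow> bool" where
  "twins V E v u \<longleftrightarrow> neighbors V E v \<union> {v} = neighbors V E u \<union> {u}"

definition no_isolated_vertex :: "'a set \<Rightarrow> 'a set set \<Rightarrow> bool" where
  "no_isolated_vertex V E \<longleftrightarrow> (\<forall>v\<in>V. neighbors V E v \<noteq> {})"

section \<open>Nondeterministic programs with step counting\<close>

text \<open>
  A program is the set of its possible runs, each given by its result and the number of time
  steps it takes. The machine is a unit-cost RAM that gets the graph as a list of its vertices
  together with its adjacency matrix. The only basic programs are \<open>step\<close>, which is only ever
  applied to constant-time computations on values already at hand (one lookup in the adjacency
  matrix, one comparison of vertices, one addition or comparison of numbers, building or
  returning boundedly many pairs and list cells, with sharing of their components), and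
  \<open>pick\<close>, the arbitrary choice of an element of a list. Both take one time step.
\<close>

datatype 'a prog = Prog (runs: "('a \<times> nat) set")

definition step :: "'a \<Rightarrow> 'a prog" where
  "step x = Prog {(x, 1)}"

definition pick :: "'a list \<Rightarrow> 'a prog" where
  "pick xs = Prog {(x, 1) | x. x \<in> set xs}"

definition bind_prog :: "'a prog \<Rightarrow> ('a \<Rightarrow> 'b prog) \<Rightarrow> 'b prog" where
  "bind_prog p f = Prog {(y, s + t) | x s y t. (x, s) \<in> runs p \<and> (y, t) \<in> runs (f x)}"

adhoc_overloading Monad_Syntax.bind \<rightleftharpoons> bind_prog

lemma bind_prog_cong [fundef_cong]:
  assumes "p = p'" and "\<And>x s. (x, s) \<in> runs p' \<Longrightarrow> f x = f' x"
  shows "bind_prog p f = bind_prog p' f'"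
  using assms by (auto simp: bind_prog_def) metis+

lemma runs_step [simp]: "runs (step x) = {(x, 1)}"
  by (simp add: step_def)

lemma runs_pick [simp]: "(y, t) \<in> runs (pick xs) \<longleftrightarrow> y \<in> set xs \<and> t = 1"
  by (auto simp: pick_def)

lemma runs_bind [simp]:
  "(y, r) \<in> runs (bind_prog p f) \<longleftrightarrow>
     (\<exists>x s t. (x, s) \<in> runs p \<and> (y, t) \<in> runs (f x) \<and> r = s + t)"
  by (auto simp: bind_prog_def)

section \<open>The algorithm\<close>

subsection \<open>Partition of the vertices into closed neighborhoods\<close>

definition in_closed_nbhd :: "('a \<Rightarrow> 'a \<Rightarrow> bool) \<Rightarrow> 'a \<Rightarrow> 'a \<Rightarrow> bool prog" where
  "in_closed_nbhd adj v w = do {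
     b \<leftarrow> step (w = v);
     if b then step True else step (adj v w)
   }"

fun agree_on :: "('a \<Rightarrow> 'a \<Rightarrow> bool) \<Rightarrow> 'a \<Rightarrow> 'a \<Rightarrow> 'a list \<Rightarrow> bool prog" where
  "agree_on adj v u [] = step True"
| "agree_on adj v u (w # ws) = do {
     a \<leftarrow> in_closed_nbhd adj v w;
     b \<leftarrow> in_closed_nbhd adj u w;
     c \<leftarrow> step (a = b);
     if c then agree_on adj v u ws else step False
   }"

text \<open>
  The comparison of the closed neighborhoods of \<open>v\<close> and \<open>u\<close> looks at \<open>u\<close> first, so that it
  takes constant time if \<open>u\<close> and \<open>v\<close> are distinct and not adjacent.
\<close>

definition twins_test :: "('a \<Rightarrow> 'a \<Rightarrow> bool) \<Rightarrow> 'a list \<Rightarrow> 'a \<Rightarrow> 'a \<Rightarrow> bool prog" where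
  "twins_test adj vs v u = agree_on adj v u (u # vs)"

fun split_class ::
  "('a \<Rightarrow> 'a \<Rightarrow> bool) \<Rightarrow> 'a list \<Rightarrow> 'a \<Rightarrow> 'a list \<Rightarrow> ('a list \<times> 'a list) prog" where
  "split_class adj vs v [] = step ([], [])"
| "split_class adj vs v (u # U) = do {
     b \<leftarrow> twins_test adj vs v u;
     (C, R) \<leftarrow> split_class adj vs v U;
     if b then step (u # C, R) else step (C, u # R)
   }"

lemma in_closed_nbhd_result:
  "(b, t) \<in> runs (in_closed_nbhd adj v w) \<Longrightarrow> b \<longleftrightarrow> w = v \<or> adj v w"
  by (auto simp: in_closed_nbhd_def split: if_splits)

lemma agree_on_result:
  "(b, t) \<in> runs (agree_on adj v u ws) \<Longrightarrow>
     b \<longleftrightarrow> (\<forall>w\<in>set ws. (w = v \<or> adj v w) \<longleftrightarrow> (w = u \<or> adj u w))"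
  by (induction ws arbitrary: b t) (auto dest!: in_closed_nbhd_result split: if_splits)

lemma twins_test_result:
  assumes "simple_graph V E" "set vs = V" "u \<in> V" "v \<in> V"
    and "(b, t) \<in> runs (twins_test (\<lambda>x y. {x, y} \<in> E) vs v u)"
  shows "b \<longleftrightarrow> twins V E v u"
  using agree_on_result[OF assms(5)[unfolded twins_test_def]] assms(2-4)
  by (auto simp: twins_def neighbors_def insert_commute)

lemma split_class_result:
  "(CR, t) \<in> runs (split_class adj vs v U) \<Longrightarrow>
     length (fst CR) + length (snd CR) = length U \<and> (v \<in> set U \<longrightarrow> fst CR \<noteq> [])"
proof (induction U arbitrary: CR t)
  case (Cons u U)
  from Cons.prems obtain b s C R r where
    b: "(b, s) \<in> runs (twins_test adj vs v u)" and CR: "((C, R), r) \<in> runs (split_class adj vs v U)"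
    and eq: "CR = (if b then (u # C, R) else (C, u # R))"
    by (fastforce split: if_splits)
  have "b" if "u = v"
    using agree_on_result[OF b[unfolded twins_test_def]] that by simp
  with Cons.IH[OF CR] eq show ?case by auto
qed simp

function collect_classes ::
  "('a \<Rightarrow> 'a \<Rightarrow> bool) \<Rightarrow> 'a list \<Rightarrow> 'a list \<Rightarrow> 'a list list \<Rightarrow> 'a list list prog" where
  "collect_classes adj vs U \<C> =
     (if U = [] then step \<C>
      else do {
        v \<leftarrow> pick U;
        (C, R) \<leftarrow> split_class adj vs v U;
        collect_classes adj vs R (C # \<C>)
      })"
  by pat_completeness auto
termination
proof (relation "measure (\<lambda>(adj, vs, U, \<C>). length U)", goal_cases)
  case (2 adj vs U \<C> v s CR t C R)
  then show ?case
    using split_class_result[of CR t adj vs v U] by (auto simp flip: length_greater_0_conv)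
qed simp

declare collect_classes.simps [simp del]

subsection \<open>One representative of each class\<close>

text \<open>
  The vertex set of \<open>G'\<close> is a list of triples \<open>(v', k, C')\<close>: a vertex \<open>v'\<close> picked from the
  class \<open>C'\<close>, and the size \<open>k\<close> of that class.
\<close>

type_synonym 'a rep = "'a \<times> nat \<times> 'a list"

fun list_size :: "'a list \<Rightarrow> nat prog" where
  "list_size [] = step 0"
| "list_size (x # xs) = do { k \<leftarrow> list_size xs; step (k + 1) }"

fun representatives :: "'a list list \<Rightarrow> 'a rep list prog" where
  "representatives [] = step []"
| "representatives (C # \<C>) = do {
     v \<leftarrow> pick C;
     k \<leftarrow> list_size C;
     R \<leftarrow> representatives \<C>;
     step ((v, k, C) # R)
   }"

subsection \<open>Exhaustive search\<close>

fun adjacent_all :: "('a \<Rightarrow> 'a \<Rightarrow> bool) \<Rightarrow> 'a \<Rightarrow> 'a rep list \<Rightarrow> bool prog" where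
  "adjacent_all adj v [] = step True"
| "adjacent_all adj v ((u, _) # S) = do {
     b \<leftarrow> step (adj v u);
     if b then adjacent_all adj v S else step False
   }"

fun clique_test :: "('a \<Rightarrow> 'a \<Rightarrow> bool) \<Rightarrow> 'a rep list \<Rightarrow> bool prog" where
  "clique_test adj [] = step True"
| "clique_test adj ((v, _) # S) = do {
     b \<leftarrow> adjacent_all adj v S;
     if b then clique_test adj S else step False
   }"

text \<open>The classes are disjoint, so the size of their union is the sum of their sizes.\<close>

fun union_size :: "'a rep list \<Rightarrow> nat prog" where
  "union_size [] = step 0"
| "union_size ((_, k, _) # S) = do { l \<leftarrow> union_size S; step (k + l) }"

fun better :: "(nat \<times> 'b) option \<Rightarrow> (nat \<times> 'b) option \<Rightarrow> (nat \<times> 'b) option" where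
  "better None r = r"
| "better (Some p) None = Some p"
| "better (Some p) (Some q) = (if fst q \<le> fst p then Some p else Some q)"

fun filter_adjacent :: "('a \<Rightarrow> 'a \<Rightarrow> bool) \<Rightarrow> 'a \<Rightarrow> 'a rep list \<Rightarrow> 'a rep list prog" where
  "filter_adjacent adj v [] = step []"
| "filter_adjacent adj v (y # ys) = do {
     b \<leftarrow> step (adj v (fst y));
     zs \<leftarrow> filter_adjacent adj v ys;
     if b then step (y # zs) else step zs
   }"

lemma filter_adjacent_length:
  "(zs, t) \<in> runs (filter_adjacent adj v ys) \<Longrightarrow> length zs \<le> length ys"
  by (induction ys arbitrary: zs t) (fastforce split: if_splits)+

text \<open>
  \<open>subset_search skip adj S ys\<close> searches the sets that consist of \<open>S\<close> and a subset of \<open>ys\<close> for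
  a clique whose classes have the largest union. If \<open>skip\<close> is false, then all subsets of \<open>ys\<close>
  are generated. If \<open>skip\<close> is true, then supersets of sets that are known not to be cliques are
  not generated: once \<open>y\<close> is included, only vertices adjacent to \<open>y\<close> remain candidates.
  The distinction matters for graphs with isolated vertices only: these lie in no clique of an
  edge clique cover, yet each of them is a class of its own. For instance, \<open>n\<close> isolated vertices
  have intersection number \<open>0\<close>, but \<open>G'\<close> has \<open>2 ^ n\<close> subsets of vertices.
\<close>

function subset_search ::
  "bool \<Rightarrow> ('a \<Rightarrow> 'a \<Rightarrow> bool) \<Rightarrow> 'a rep list \<Rightarrow> 'a rep list \<Rightarrow> (nat \<times> 'a rep list) option prog"
where
  "subset_search skip adj S [] = do {
     b \<leftarrow> clique_test adj S;
     if b then do { k \<leftarrow> union_size S; step (Some (k, S)) } else step None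
   }"
| "subset_search skip adj S (y # ys) = do {
     zs \<leftarrow> (if skip then filter_adjacent adj (fst y) ys else step ys);
     r \<leftarrow> subset_search skip adj (y # S) zs;
     r' \<leftarrow> subset_search skip adj S ys;
     step (better r r')
   }"
  by pat_completeness auto
termination
proof (relation "measure (\<lambda>(skip, adj, S, ys). length ys)", goal_cases)
  case (2 skip adj S y ys zs t)
  then show ?case by (auto dest!: filter_adjacent_length split: if_splits)
qed auto

fun append_prog :: "'a list \<Rightarrow> 'a list \<Rightarrow> 'a list prog" where
  "append_prog [] ys = step ys"
| "append_prog (x # xs) ys = do { zs \<leftarrow> append_prog xs ys; step (x # zs) }"

fun union_classes :: "'a rep list \<Rightarrow> 'a list prog" where
  "union_classes [] = step []"
| "union_classes ((_, _, C) # S) = do { Q \<leftarrow> union_classes S; append_prog C Q }"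

subsection \<open>The complete algorithm\<close>

text \<open>
  The search never results in \<open>None\<close>, as the empty set is a clique.
\<close>

definition find_max_clique :: "bool \<Rightarrow> ('a \<Rightarrow> 'a \<Rightarrow> bool) \<Rightarrow> 'a list \<Rightarrow> 'a list prog" where
  "find_max_clique skip adj vs = do {
     \<C> \<leftarrow> collect_classes adj vs vs [];
     V' \<leftarrow> representatives \<C>;
     r \<leftarrow> subset_search skip adj [] V';
     (case r of None \<Rightarrow> step [] | Some (_, S) \<Rightarrow> union_classes S)
   }"

end

theory Submission
  imports Defs "HOL-Library.Sublist"
begin

text \<open>
  Fix a minimum edge clique cover with \<open>m\<close> cliques. The closed neighborhood of a vertex with a
  neighbor is the union of the cover cliques that contain it, so such vertices that lie in the same
  cover cliques are twins, and they form fewer than \<open>2 ^ m\<close> classes. An isolated vertex is a class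
  of its own, but splitting off its class takes only linear time, because it fails the first
  comparison with every other vertex; likewise the search with \<open>skip\<close> abandons it at once. Hence
  only the classes of nonisolated vertices contribute to the quadratic term of the partitioning and
  to the exponent of the search.

  A union of classes is a clique iff the representatives form a clique, and every clique is
  contained in the union of the classes it meets, so the heaviest clique of representatives yields a
  maximum clique.
\<close>

section \<open>Lists\<close>

lemma sorted_wrt_if_distinct:
  assumes "distinct xs" and "\<And>x y. x \<in> set xs \<Longrightarrow> y \<in> set xs \<Longrightarrow> x \<noteq> y \<Longrightarrow> P x y"
  shows "sorted_wrt P xs"
  using assms by (induction xs) auto

lemma set_subseq_subset: "subseq xs ys \<Longrightarrow> set xs \<subseteq> set ys"
  by (auto elim: list_emb_set)

lemma distinct_subseq: "subseq xs ys \<Longrightarrow> distinct ys \<Longrightarrow> distinct xs"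
  by (induction rule: list_emb.induct) (auto dest: set_subseq_subset)

section \<open>Step counts and results of the basic procedures\<close>

lemma in_closed_nbhd_time: "(b, t) \<in> runs (in_closed_nbhd adj v w) \<Longrightarrow> t = 2"
  by (auto simp: in_closed_nbhd_def split: if_splits)

lemma agree_on_time: "(b, t) \<in> runs (agree_on adj v u ws) \<Longrightarrow> t \<le> 5 * length ws + 1"
proof (induction ws arbitrary: b t)
  case (Cons w ws)
  then show ?case
    by (fastforce dest!: in_closed_nbhd_time split: if_splits)
qed simp

lemma twins_test_time: "(b, t) \<in> runs (twins_test adj vs v u) \<Longrightarrow> t \<le> 5 * length vs + 6"
  unfolding twins_test_def using agree_on_time by fastforce

text \<open>The list that is compared starts with \<open>u\<close>, which lies in its own closed
  neighborhood but not in that of \<open>v\<close>, so the very first comparison fails.\<close>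

lemma twins_test_time_nonadjacent:
  assumes "(b, t) \<in> runs (twins_test adj vs v u)" and "u \<noteq> v" and "\<not> adj v u"
  shows "t \<le> 6"
proof -
  from assms(1) obtain a s b' s' r where
    a: "(a, s) \<in> runs (in_closed_nbhd adj v u)" and b: "(b', s') \<in> runs (in_closed_nbhd adj u u)"
    and r: "(b, r) \<in> runs (if a = b' then agree_on adj v u vs else step False)"
    and t: "t = s + s' + 1 + r"
    by (auto simp: twins_test_def)
  have "a \<noteq> b'"
    using in_closed_nbhd_result[OF a] in_closed_nbhd_result[OF b] assms(2,3) by blast
  then show ?thesis using r t in_closed_nbhd_time[OF a] in_closed_nbhd_time[OF b] by simp
qed

lemma split_class_time:
  "(CR, t) \<in> runs (split_class adj vs v U) \<Longrightarrow> t \<le> length U * (5 * length vs + 7) + 1"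
proof (induction U arbitrary: CR t)
  case (Cons u U)
  then show ?case
    by (fastforce dest!: twins_test_time split: if_splits)
qed simp

text \<open>Each \<open>u\<close> other than \<open>v\<close> costs at most 6 steps for the test and
  one for the cell. Only the test of \<open>v\<close> against itself can run through all of
  \<open>vs\<close>, and distinctness of \<open>U\<close> lets it occur at most once.\<close>

lemma split_class_time_isolated:
  assumes "(CR, t) \<in> runs (split_class adj vs v U)" and "distinct U"
    and "\<And>u. u \<in> set U \<Longrightarrow> u \<noteq> v \<Longrightarrow> \<not> adj v u"
  shows "t \<le> 7 * length U + 1 + (if v \<in> set U then 5 * length vs else 0)"
  using assms
proof (induction U arbitrary: CR t)
  case (Cons u U)
  from Cons.prems(1) obtain b s C R r where
    b: "(b, s) \<in> runs (twins_test adj vs v u)" and CR: "((C, R), r) \<in> runs (split_class adj vs v U)"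
    and t: "t = s + r + 1"
    by (fastforce split: if_splits)
  have r: "r \<le> 7 * length U + 1 + (if v \<in> set U then 5 * length vs else 0)"
    using Cons.IH[OF CR] Cons.prems by auto
  show ?case
  proof (cases "u = v")
    case True
    then show ?thesis using r t twins_test_time[OF b] Cons.prems(2) by auto
  next
    case False
    then have "s \<le> 6" using twins_test_time_nonadjacent[OF b] Cons.prems(3) by auto
    then show ?thesis using r t False by auto
  qed
qed simp

lemma list_size_run: "(k, t) \<in> runs (list_size xs) \<longleftrightarrow> k = length xs \<and> t = length xs + 1"
  by (induction xs arbitrary: k t) auto

lemma representatives_run:
  assumes "(R, t) \<in> runs (representatives \<C>)"
  shows "map (snd \<circ> snd) R = \<C> \<and> (\<forall>(v, k, C) \<in> set R. v \<in> set C \<and> k = length C) \<and>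
    t = length (concat \<C>) + 3 * length \<C> + 1"
  using assms
proof (induction \<C> arbitrary: R t)
  case (Cons C \<C>)
  then show ?case by (fastforce simp: list_size_run)
qed simp

lemma adjacent_all_result:
  "(b, t) \<in> runs (adjacent_all adj v S) \<Longrightarrow> b \<longleftrightarrow> (\<forall>x\<in>set S. adj v (fst x))"
  by (induction adj v S arbitrary: b t rule: adjacent_all.induct) (auto split: if_splits)

lemma adjacent_all_time: "(b, t) \<in> runs (adjacent_all adj v S) \<Longrightarrow> t \<le> length S + 1"
  by (induction adj v S arbitrary: b t rule: adjacent_all.induct) (fastforce split: if_splits)+

lemma clique_test_result:
  "(b, t) \<in> runs (clique_test adj S) \<Longrightarrow> b \<longleftrightarrow> sorted_wrt (\<lambda>x y. adj (fst x) (fst y)) S"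
proof (induction adj S arbitrary: b t rule: clique_test.induct)
  case (2 adj v w S)
  then obtain b1 t1 t2 where *: "(b1, t1) \<in> runs (adjacent_all adj v S)"
    "(b, t2) \<in> runs (if b1 then clique_test adj S else step False)"
    by auto
  then show ?case
    using adjacent_all_result[OF *(1)] "2.IH"[OF *(1), of b t2] by (simp split: if_splits)
qed simp

lemma clique_test_time: "(b, t) \<in> runs (clique_test adj S) \<Longrightarrow> t \<le> (length S + 1)\<^sup>2"
proof (induction adj S arbitrary: b t rule: clique_test.induct)
  case (2 adj v w S)
  then obtain b1 t1 t2 where *: "(b1, t1) \<in> runs (adjacent_all adj v S)" "t = t1 + t2"
    "(b, t2) \<in> runs (if b1 then clique_test adj S else step False)"
    by auto
  have "t2 \<le> (length S + 1)\<^sup>2"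
    using *(3) 2(1)[OF *(1)] by (auto split: if_splits)
  moreover have "t1 \<le> length S + 1" using adjacent_all_time[OF *(1)] .
  ultimately show ?case using *(2) by (simp add: power2_eq_square)
qed simp

definition weight :: "'a rep list \<Rightarrow> nat" where
  "weight S = sum_list (map (fst \<circ> snd) S)"

lemma union_size_run: "(k, t) \<in> runs (union_size S) \<longleftrightarrow> k = weight S \<and> t = length S + 1"
  by (induction S arbitrary: k t rule: union_size.induct) (auto simp: weight_def)

lemma filter_adjacent_run:
  "(zs, t) \<in> runs (filter_adjacent adj v ys) \<longleftrightarrow>
     zs = filter (\<lambda>y. adj v (fst y)) ys \<and> t = 2 * length ys + 1"
  by (induction ys arbitrary: zs t) (auto split: if_splits)

lemma append_prog_run: "(zs, t) \<in> runs (append_prog xs ys) \<longleftrightarrow> zs = xs @ ys \<and> t = length xs + 1"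
  by (induction xs arbitrary: zs t) auto

lemma union_classes_run:
  "(Q, t) \<in> runs (union_classes S) \<longleftrightarrow>
     Q = concat (map (snd \<circ> snd) S) \<and> t = length Q + length S + 1"
  by (induction S arbitrary: Q t rule: union_classes.induct) (auto simp: append_prog_run)

section \<open>Every procedure has a run\<close>

text \<open>Statements about all runs hold vacuously for a program without runs, and
  \<open>pick []\<close> is such a program. The existence of a run is therefore proved
  separately.\<close>

definition has_run :: "'a prog \<Rightarrow> bool" where
  "has_run p \<longleftrightarrow> runs p \<noteq> {}"

lemma has_runI: "(x, t) \<in> runs p \<Longrightarrow> has_run p"
  by (auto simp: has_run_def)

lemma has_run_step [simp]: "has_run (step x)"
  by (simp add: has_run_def)

lemma has_run_pick [simp]: "has_run (pick xs) \<longleftrightarrow> xs \<noteq> []"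
  by (cases xs) (auto simp: has_run_def pick_def)

lemma has_run_bind:
  assumes "has_run p" and "\<And>x s. (x, s) \<in> runs p \<Longrightarrow> has_run (f x)"
  shows "has_run (bind_prog p f)"
  using assms by (fastforce simp: has_run_def bind_prog_def)

lemma has_run_in_closed_nbhd [simp]: "has_run (in_closed_nbhd adj v w)"
  unfolding in_closed_nbhd_def by (intro has_run_bind) simp_all

lemma has_run_agree_on [simp]: "has_run (agree_on adj v u ws)"
  by (induction ws) (simp_all add: has_run_bind)

lemma has_run_twins_test [simp]: "has_run (twins_test adj vs v u)"
  by (simp add: twins_test_def del: agree_on.simps)

lemma has_run_split_class [simp]: "has_run (split_class adj vs v U)"
  by (induction U) (simp_all add: has_run_bind split: prod.split)

lemma has_run_collect_classes: "has_run (collect_classes adj vs U \<C>)"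
proof (induction adj vs U \<C> rule: collect_classes.induct)
  case (1 adj vs U \<C>)
  then show ?case
    by (subst collect_classes.simps) (auto intro!: has_run_bind)
qed

lemma has_run_representatives: "[] \<notin> set \<C> \<Longrightarrow> has_run (representatives \<C>)"
proof (induction \<C>)
  case (Cons C \<C>)
  have "has_run (list_size C)" using list_size_run by (blast intro: has_runI)
  with Cons show ?case by (auto intro!: has_run_bind)
qed simp

lemma has_run_adjacent_all [simp]: "has_run (adjacent_all adj v S)"
  by (induction adj v S rule: adjacent_all.induct) (auto intro!: has_run_bind)

lemma has_run_clique_test [simp]: "has_run (clique_test adj S)"
  by (induction adj S rule: clique_test.induct) (auto intro!: has_run_bind)

lemma has_run_union_classes [simp]: "has_run (union_classes S)"
  using union_classes_run by (blast intro: has_runI)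

lemma has_run_subset_search: "has_run (subset_search skip adj S ys)"
proof (induction skip adj S ys rule: subset_search.induct)
  case (1 skip adj S)
  have "has_run (union_size S)" using union_size_run by (blast intro: has_runI)
  then show ?case by (auto intro!: has_run_bind)
next
  case (2 skip adj S y ys)
  have "has_run (filter_adjacent adj (fst y) ys)"
    by (rule has_runI[of "filter (\<lambda>x. adj (fst y) (fst x)) ys" "2 * length ys + 1"])
      (simp add: filter_adjacent_run)
  then show ?case
    unfolding subset_search.simps by (intro has_run_bind 2) simp_all
qed

section \<open>Exhaustive search\<close>

text \<open>Included entries are pushed onto \<open>S\<close>, so the chosen sublist comes out
  reversed. The clique property stems from the test at the leaf alone, hence it holds for either
  value of \<open>skip\<close>.\<close>

lemma subset_search_sound:
  assumes "(r, t) \<in> runs (subset_search skip adj S ys)" and "r = Some (k, L)"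
  shows "\<exists>zs. subseq zs ys \<and> L = rev zs @ S \<and> sorted_wrt (\<lambda>x y. adj (fst x) (fst y)) L \<and> k = weight L"
  using assms
proof (induction skip adj S ys arbitrary: r t k L rule: subset_search.induct)
  case (1 skip adj S)
  then show ?case
    by (auto simp: union_size_run dest!: clique_test_result split: if_splits)
next
  case (2 skip adj S y ys)
  from "2.prems"(1) obtain zs t0 r1 t1 r2 t2 where
    zs: "(zs, t0) \<in> runs (if skip then filter_adjacent adj (fst y) ys else step ys)"
    and r1: "(r1, t1) \<in> runs (subset_search skip adj (y # S) zs)"
    and r2: "(r2, t2) \<in> runs (subset_search skip adj S ys)"
    and r: "r = better r1 r2"
    by auto
  have "subseq zs ys"
    using zs by (auto simp: filter_adjacent_run split: if_splits)
  moreover have "r1 = Some (k, L) \<or> r2 = Some (k, L)"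
    using r "2.prems"(2) by (cases r1; cases r2) (auto split: if_splits)
  ultimately show ?case
  proof (elim disjE)
    assume "r1 = Some (k, L)"
    from "2.IH"(1)[OF zs r1 this] obtain zs' where "subseq zs' zs" "L = rev (y # zs') @ S"
      "sorted_wrt (\<lambda>x y. adj (fst x) (fst y)) L" "k = weight L"
      by auto
    with \<open>subseq zs ys\<close> show ?case
      by (intro exI[of _ "y # zs'"]) (auto intro: subseq_order.trans)
  next
    assume "r2 = Some (k, L)"
    from "2.IH"(2)[OF zs r1 r2 this] show ?case by (auto intro: list_emb_Cons)
  qed
qed

text \<open>Pruning loses no clique: once \<open>y\<close> is included, the later members of a
  clique containing \<open>y\<close> are all adjacent to \<open>y\<close> and survive the filter.
  With \<open>better\<close> the maximum over both branches is kept.\<close>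

lemma subset_search_complete:
  assumes "(r, t) \<in> runs (subset_search skip adj S ys)" and "symp adj"
    and "subseq zs ys" and "sorted_wrt (\<lambda>x y. adj (fst x) (fst y)) (rev zs @ S)"
  shows "\<exists>k L. r = Some (k, L) \<and> weight (rev zs @ S) \<le> k"
  using assms
proof (induction skip adj S ys arbitrary: r t zs rule: subset_search.induct)
  case (1 skip adj S)
  then have "zs = []" by simp
  with 1 show ?case
    by (auto simp: union_size_run dest!: clique_test_result split: if_splits)
next
  case (2 skip adj S y ys)
  from "2.prems"(1) obtain ws t0 r1 t1 r2 t2 where
    ws: "(ws, t0) \<in> runs (if skip then filter_adjacent adj (fst y) ys else step ys)"
    and r1: "(r1, t1) \<in> runs (subset_search skip adj (y # S) ws)"
    and r2: "(r2, t2) \<in> runs (subset_search skip adj S ys)"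
    and r: "r = better r1 r2"
    by auto
  from \<open>subseq zs (y # ys)\<close> consider (skipped) "subseq zs ys"
    | (included) zs' where "zs = y # zs'" "subseq zs' ys"
    by (cases rule: list_emb.cases) auto
  then have "(\<exists>k L. r1 = Some (k, L) \<and> weight (rev zs @ S) \<le> k) \<or>
    (\<exists>k L. r2 = Some (k, L) \<and> weight (rev zs @ S) \<le> k)"
  proof cases
    case skipped
    then show ?thesis using "2.IH"(2)[OF ws r1 r2 "2.prems"(2)] "2.prems"(4) by blast
  next
    case included
    \<comment> \<open>In \<open>rev zs\<close> the entry \<open>y\<close> comes after those of
      \<open>zs'\<close>, so sortedness gives adjacency to \<open>y\<close> in the opposite
      direction; symmetry turns it around.\<close>
    have "\<forall>x\<in>set zs'. adj (fst y) (fst x)"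
      using "2.prems"(2,4) included by (auto simp: sorted_wrt_append dest: sympD)
    then have "filter (\<lambda>x. adj (fst y) (fst x)) zs' = zs'" by simp
    with \<open>subseq zs' ys\<close> have "subseq zs' (filter (\<lambda>x. adj (fst y) (fst x)) ys)"
      by (metis subseq_filter)
    with \<open>subseq zs' ys\<close> ws have "subseq zs' ws"
      by (auto simp: filter_adjacent_run split: if_splits)
    with "2.IH"(1)[OF ws r1 "2.prems"(2)] "2.prems"(4) included show ?thesis by auto
  qed
  then show ?case unfolding r by (cases r1; cases r2) auto
qed

section \<open>Running time of the search\<close>

lemma leaf_time:
  assumes "(r, t) \<in> runs (subset_search skip adj S [])"
  shows "t \<le> (length S + 1)\<^sup>2 + length S + 2"
  using assms by (fastforce simp: union_size_run dest!: clique_test_time split: if_splits)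

text \<open>The summand \<open>2 * N + 2\<close> strengthens the induction: an inner node spends at
  most that much on filtering and combining, and the surplus of one of its two subtrees pays for it.
  At a leaf the factor 5 absorbs the surplus.\<close>

lemma subset_search_time:
  assumes "(r, t) \<in> runs (subset_search skip adj S ys)" and "length S + length ys \<le> N"
  shows "t + 2 * N + 2 \<le> 2 ^ length ys * (5 * (N + 1)\<^sup>2)"
  using assms
proof (induction skip adj S ys arbitrary: r t rule: subset_search.induct)
  case (1 skip adj S)
  have "t \<le> (length S + 1)\<^sup>2 + length S + 2" using leaf_time[OF "1.prems"(1)] .
  also have "\<dots> \<le> (N + 1)\<^sup>2 + N + 2"
    using "1.prems"(2) by (intro add_mono power_mono) auto
  finally show ?case by (simp add: power2_eq_square)
next
  case (2 skip adj S y ys)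
  from "2.prems"(1) obtain ws t0 r1 t1 r2 t2 where
    ws: "(ws, t0) \<in> runs (if skip then filter_adjacent adj (fst y) ys else step ys)"
    and r1: "(r1, t1) \<in> runs (subset_search skip adj (y # S) ws)"
    and r2: "(r2, t2) \<in> runs (subset_search skip adj S ys)"
    and t: "t = t0 + t1 + t2 + 1"
    by auto
  have len: "length ws \<le> length ys" and t0: "t0 \<le> 2 * length ys + 1"
    using ws by (auto simp: filter_adjacent_run split: if_splits)
  have "t1 + 2 * N + 2 \<le> 2 ^ length ws * (5 * (N + 1)\<^sup>2)"
    using "2.IH"(1)[OF ws r1] "2.prems"(2) len by simp
  also have "\<dots> \<le> 2 ^ length ys * (5 * (N + 1)\<^sup>2)"
    using len by (intro mult_right_mono power_increasing) auto
  finally have "t1 + 2 * N + 2 \<le> 2 ^ length ys * (5 * (N + 1)\<^sup>2)" .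
  moreover have "t2 + 2 * N + 2 \<le> 2 ^ length ys * (5 * (N + 1)\<^sup>2)"
    using "2.IH"(2)[OF ws r1 r2] "2.prems"(2) by simp
  ultimately show ?case using t t0 "2.prems"(2) by simp
qed

text \<open>
  A vertex outside \<open>P\<close> (isolated in the application) empties the candidate list when it is
  included, so only the vertices in \<open>P\<close> contribute to the exponent.
\<close>

lemma subset_search_time_skip:
  assumes "(r, t) \<in> runs (subset_search True adj [] ys)"
    and "\<And>u v. adj u v \<Longrightarrow> P u \<and> P v"
    and "length (filter (\<lambda>x. P (fst x)) ys) \<le> N" and "length ys \<le> n"
  shows "t \<le> length ys * (2 * n + 7) + 2 ^ length (filter (\<lambda>x. P (fst x)) ys) * (5 * (N + 1)\<^sup>2)"
  using assms(1,3,4)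
proof (induction ys arbitrary: r t)
  case Nil
  then have "t \<le> 3" using leaf_time[OF Nil(1)] by simp
  then show ?case by (simp add: power2_eq_square)
next
  case (Cons y ys)
  define ws where "ws = filter (\<lambda>x. adj (fst y) (fst x)) ys"
  from Cons.prems(1) obtain r1 t1 r2 t2 where
    r1: "(r1, t1) \<in> runs (subset_search True adj [y] ws)"
    and r2: "(r2, t2) \<in> runs (subset_search True adj [] ys)"
    and t: "t = 2 * length ys + 1 + t1 + t2 + 1"
    by (auto simp: filter_adjacent_run ws_def)
  let ?a = "length (filter (\<lambda>x. P (fst x)) ys)"
  have IH: "t2 \<le> length ys * (2 * n + 7) + 2 ^ ?a * (5 * (N + 1)\<^sup>2)"
    using Cons.IH[OF r2] Cons.prems(2,3) by (simp split: if_splits)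
  show ?case
  proof (cases "P (fst y)")
    case True
    \<comment> \<open>Adjacency implies \<open>P\<close>, so the remaining candidates are among the
      \<open>?a\<close> entries in \<open>P\<close>. As \<open>y\<close> is one more such entry,
      \<open>[y]\<close> and \<open>ws\<close> together have length at most
      \<open>N\<close>.\<close>
    have "ws = filter (\<lambda>x. adj (fst y) (fst x)) (filter (\<lambda>x. P (fst x)) ys)"
      unfolding ws_def filter_filter using assms(2) by (intro filter_cong) auto
    then have len: "length ws \<le> ?a" by (simp only: length_filter_le)
    have "t1 \<le> 2 ^ length ws * (5 * (N + 1)\<^sup>2)"
      using subset_search_time[OF r1, of N] len True Cons.prems by simp
    also have "\<dots> \<le> 2 ^ ?a * (5 * (N + 1)\<^sup>2)"
      using len by (intro mult_right_mono power_increasing) auto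
    finally show ?thesis using t IH True Cons.prems by simp
  next
    case False
    \<comment> \<open>An entry outside \<open>P\<close> is adjacent to nothing, so including it
      leads to a leaf with \<open>S = [y]\<close>, which costs at most 4 + 1 + 2 steps. With
      filtering and combining this stays within \<open>2 * n + 7\<close>.\<close>
    then have "ws = []" using assms(2) by (auto simp: ws_def filter_empty_conv)
    then have "t1 \<le> 7" using leaf_time r1 by (fastforce simp: power2_eq_square)
    then show ?thesis using t IH False Cons.prems by simp
  qed
qed

section \<open>Closed neighborhoods and edge clique covers\<close>

lemma twins_refl: "twins V E v v"
  and twins_sym: "twins V E u v \<Longrightarrow> twins V E v u"
  and twins_trans: "twins V E u v \<Longrightarrow> twins V E v w \<Longrightarrow> twins V E u w"
  by (auto simp: twins_def)

text \<open>The edge is moved one end at a time: \<open>w\<close> lies in the closed neighborhood of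
  \<open>u\<close>, hence in that of \<open>x\<close>; so \<open>x\<close> lies in that of
  \<open>w\<close>, hence in that of \<open>y\<close>. Adjacency of distinct classes thus does not
  depend on the chosen vertices.\<close>

lemma twins_adjacent:
  assumes "twins V E u x" and "twins V E w y" and "{u, w} \<in> E" and "x \<noteq> y"
    and "u \<in> V" "w \<in> V" "x \<in> V" "y \<in> V"
  shows "{x, y} \<in> E"
proof -
  have "w \<in> neighbors V E u \<union> {u}" using assms by (simp add: neighbors_def insert_commute)
  then have "w = x \<or> {w, x} \<in> E" using assms(1) by (auto simp: twins_def neighbors_def)
  then have "x \<in> neighbors V E w \<union> {w}"
    using assms by (auto simp: neighbors_def insert_commute)
  then show ?thesis using assms(2,4) by (auto simp: twins_def neighbors_def)
qed

lemma twins_imp_edge: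
  assumes "twins V E u x" and "u \<noteq> x" and "u \<in> V"
  shows "{u, x} \<in> E"
  using assms by (auto simp: twins_def neighbors_def)

lemma ex_minimum_edge_clique_cover:
  assumes "simple_graph V E"
  obtains \<K> where "edge_clique_cover V E \<K>" and "card \<K> = intersection_number V E"
proof -
  have E: "e \<subseteq> V" "card e = 2" if "e \<in> E" for e
    using assms that by (auto simp: simple_graph_def)
  have "E \<subseteq> Pow V" "finite V" using assms by (auto simp: simple_graph_def)
  then have "finite E" by (meson finite_Pow_iff finite_subset)
  moreover have "clique V E e" if "e \<in> E" for e
  proof -
    obtain a b where "e = {a, b}" using E(2)[OF \<open>e \<in> E\<close>] by (auto simp: card_2_iff)
    then show ?thesis using that E(1)[OF that] by (auto simp: clique_def insert_commute)
  qed
  \<comment> \<open>The edges themselves are a finite clique cover, so the minimum is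
    attained.\<close>
  ultimately have "edge_clique_cover V E E" by (auto simp: edge_clique_cover_def)
  then have "\<exists>k \<K>. edge_clique_cover V E \<K> \<and> card \<K> = k" by blast
  from LeastI_ex[OF this] show ?thesis
    using that by (auto simp: intersection_number_def)
qed

lemma closed_nbhd_eq_Union_cover:
  assumes "edge_clique_cover V E \<K>" and "v \<in> V" and "neighbors V E v \<noteq> {}"
  shows "neighbors V E v \<union> {v} = \<Union> {K \<in> \<K>. v \<in> K}"
proof
  have ex: "\<exists>K\<in>\<K>. u \<in> K \<and> v \<in> K" if "u \<in> neighbors V E v" for u
    using that assms(1) by (fastforce simp: edge_clique_cover_def neighbors_def)
  \<comment> \<open>A vertex without neighbors need not lie in any cover clique; a neighbor of
    \<open>v\<close> supplies one that contains \<open>v\<close> itself.\<close>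
  then show "neighbors V E v \<union> {v} \<subseteq> \<Union> {K \<in> \<K>. v \<in> K}" using assms(3) by blast
  show "\<Union> {K \<in> \<K>. v \<in> K} \<subseteq> neighbors V E v \<union> {v}"
  proof
    fix u
    assume "u \<in> \<Union> {K \<in> \<K>. v \<in> K}"
    then obtain K where K: "K \<in> \<K>" "v \<in> K" "u \<in> K" by blast
    with assms(1) have "clique V E K" by (simp add: edge_clique_cover_def)
    with K show "u \<in> neighbors V E v \<union> {v}" by (auto simp: clique_def neighbors_def)
  qed
qed

text \<open>Each vertex is mapped to the set of cover cliques through it. This set determines the
  closed neighborhood, so the map is injective on pairwise nontwins, and it misses the empty set,
  which makes the inequality strict.\<close>

lemma card_nontwins_less:
  assumes "simple_graph V E" and "W \<subseteq> V"
    and "\<And>v. v \<in> W \<Longrightarrow> neighbors V E v \<noteq> {}"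
    and "\<And>u v. u \<in> W \<Longrightarrow> v \<in> W \<Longrightarrow> twins V E u v \<Longrightarrow> u = v"
  shows "card W < 2 ^ intersection_number V E"
proof -
  obtain \<K> where \<K>: "edge_clique_cover V E \<K>" "card \<K> = intersection_number V E"
    using ex_minimum_edge_clique_cover[OF assms(1)] .
  have fin: "finite \<K>" using \<K>(1) by (simp add: edge_clique_cover_def)
  let ?f = "\<lambda>v. {K \<in> \<K>. v \<in> K}"
  have nbhd: "neighbors V E v \<union> {v} = \<Union> (?f v)" if "v \<in> W" for v
    using closed_nbhd_eq_Union_cover[OF \<K>(1)] assms(2,3) that by blast
  have "inj_on ?f W"
  proof (rule inj_onI)
    fix u v
    assume "u \<in> W" "v \<in> W" "?f u = ?f v"
    then have "twins V E u v" unfolding twins_def using nbhd[of u] nbhd[of v] by simp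
    with \<open>u \<in> W\<close> \<open>v \<in> W\<close> show "u = v" by (rule assms(4))
  qed
  moreover have "?f ` W \<subseteq> Pow \<K> - {{}}" using nbhd by blast
  ultimately have "card W \<le> card (Pow \<K> - {{}})"
    using fin by (intro card_inj_on_le) auto
  also have "\<dots> < card (Pow \<K>)" using fin by (intro psubset_card_mono) auto
  finally show ?thesis using fin \<K>(2) by (simp add: card_Pow)
qed

section \<open>Partition into closed neighborhoods\<close>

locale listed_graph =
  fixes V :: "'a set" and E :: "'a set set" and vs :: "'a list"
  assumes graph: "simple_graph V E" and distinct_vs: "distinct vs" and set_vs: "set vs = V"
begin

abbreviation adj :: "'a \<Rightarrow> 'a \<Rightarrow> bool" where
  "adj u v \<equiv> {u, v} \<in> E"

text \<open>Only the vertices of \<open>U\<close> are partitioned, since the partition grows over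
  the rounds, but \<open>twins\<close> always refers to the whole graph. Excluding \<open>[]\<close>
  also makes \<open>\<C>\<close> distinct and no longer than \<open>U\<close>.\<close>

definition class_list :: "'a list \<Rightarrow> 'a list list \<Rightarrow> bool" where
  "class_list U \<C> \<longleftrightarrow> distinct (concat \<C>) \<and> set (concat \<C>) = set U \<and> [] \<notin> set \<C> \<and>
     (\<forall>C\<in>set \<C>. \<forall>x\<in>set C. set C = {u \<in> set U. twins V E x u})"

definition nonisolated :: "'a \<Rightarrow> bool" where
  "nonisolated v \<longleftrightarrow> neighbors V E v \<noteq> {}"

text \<open>This number bounds both the rounds of the partitioning that take quadratic time and the
  candidates in the exponent of the search.\<close>

definition num_nonisolated :: "'a list list \<Rightarrow> nat" where
  "num_nonisolated \<C> = length (filter (\<lambda>C. \<exists>x\<in>set C. nonisolated x) \<C>)"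

lemma adj_vertices: "adj u v \<Longrightarrow> u \<in> V \<and> v \<in> V"
  using graph by (auto simp: simple_graph_def)

lemma adj_nonisolated: "adj u v \<Longrightarrow> nonisolated u \<and> nonisolated v"
  using adj_vertices[of u v] by (auto simp: nonisolated_def neighbors_def insert_commute)

lemma length_vs: "length vs = card V"
  using distinct_card[OF distinct_vs] set_vs by simp

lemma split_class_run:
  assumes "(CR, t) \<in> runs (split_class adj vs v U)" and "set U \<subseteq> V" and "v \<in> V"
  shows "CR = (filter (twins V E v) U, filter (\<lambda>u. \<not> twins V E v u) U)"
  using assms(1,2)
proof (induction U arbitrary: CR t)
  case (Cons u U)
  from Cons.prems obtain b s C R r where
    b: "(b, s) \<in> runs (twins_test adj vs v u)" and CR: "((C, R), r) \<in> runs (split_class adj vs v U)"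
    and eq: "CR = (if b then (u # C, R) else (C, u # R))"
    by (fastforce split: if_splits)
  have "b \<longleftrightarrow> twins V E v u"
    using twins_test_result[OF graph set_vs _ assms(3) b] Cons.prems by auto
  then show ?case using eq Cons.IH[OF CR] Cons.prems by auto
qed simp

text \<open>Removing one complete equivalence class cuts no other, so the classes of the remaining
  vertices are classes in \<open>U\<close> as well. The class of \<open>v\<close> goes last because
  the accumulator puts later classes in front.\<close>

lemma class_list_snoc:
  assumes "distinct U" and "v \<in> set U"
    and \<D>: "class_list (filter (\<lambda>u. \<not> twins V E v u) U) \<D>"
  shows "class_list U (\<D> @ [filter (twins V E v) U])"
proof -
  let ?C = "filter (twins V E v) U" and ?R = "filter (\<lambda>u. \<not> twins V E v u) U"
  have D: "distinct (concat \<D>)" "set (concat \<D>) = set ?R" "[] \<notin> set \<D>"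
    and cls: "\<And>C x. C \<in> set \<D> \<Longrightarrow> x \<in> set C \<Longrightarrow> set C = {u \<in> set ?R. twins V E x u}"
    using \<D> unfolding class_list_def by blast+
  have "v \<in> set ?C" using assms(2) twins_refl by simp
  then have "?C \<noteq> []" by (auto simp del: set_filter)
  moreover have "set C = {u \<in> set U. twins V E x u}" if "C \<in> set \<D>" "x \<in> set C" for C x
  proof -
    have "x \<in> set ?R" using that D(2) by (metis UN_I set_concat)
    then have "\<not> twins V E v x" by simp
    then have "\<not> twins V E v u" if "twins V E x u" for u
      using that twins_sym twins_trans by metis
    then show ?thesis using cls[OF that] by auto
  qed
  moreover have "set ?C = {u \<in> set U. twins V E x u}" if "x \<in> set ?C" for x
    using that by (simp add: twins_def)
  moreover have "distinct (concat (\<D> @ [?C]))"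
    using D(1,2) assms(1) by (simp only: concat_append distinct_append) auto
  moreover have "set (concat (\<D> @ [?C])) = set U"
    using D(2) by (simp only: concat_append set_append) auto
  ultimately show ?thesis using D(3) unfolding class_list_def
    by (metis (no_types, lifting) Un_iff empty_iff insert_iff list.set(1) list.simps(15) set_append)
qed

text \<open>Every round is charged \<open>12 * card V + 2\<close> steps, including the pick; a round
  whose picked vertex is nonisolated is charged the quadratic term in addition. The list
  \<open>\<N>\<close> separates the new classes from the accumulator.\<close>

lemma collect_classes_run:
  assumes "(\<D>, t) \<in> runs (collect_classes adj vs U \<C>)" and "set U \<subseteq> V" and "distinct U"
  shows "\<exists>\<N>. \<D> = \<N> @ \<C> \<and> class_list U \<N> \<and>
    t \<le> 1 + length \<N> * (12 * card V + 2) + num_nonisolated \<N> * (5 * (card V)\<^sup>2 + 7 * card V)"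
  using assms
proof (induction "length U" arbitrary: U \<C> t rule: less_induct)
  case less
  show ?case
  proof (cases "U = []")
    case True
    then show ?thesis
      using less.prems by (auto simp: collect_classes.simps class_list_def num_nonisolated_def)
  next
    case False
    with less.prems(1) obtain v C R s t' where v: "v \<in> set U"
      and CR: "((C, R), s) \<in> runs (split_class adj vs v U)"
      and run: "(\<D>, t') \<in> runs (collect_classes adj vs R (C # \<C>))"
      and t: "t = 1 + s + t'"
      by (subst (asm) collect_classes.simps) auto
    have C: "C = filter (twins V E v) U" and R: "R = filter (\<lambda>u. \<not> twins V E v u) U"
      using split_class_run[OF CR] less.prems v by auto
    have vC: "v \<in> set C" using v twins_refl C by simp
    have "length R < length U"
      unfolding R using v twins_refl by (intro length_filter_less) auto
    from less.hyps[OF this run] obtain \<N> where \<N>: "\<D> = \<N> @ C # \<C>" "class_list R \<N>"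
      and t': "t' \<le> 1 + length \<N> * (12 * card V + 2) +
        num_nonisolated \<N> * (5 * (card V)\<^sup>2 + 7 * card V)"
      using less.prems by (auto simp: R)
    have len: "length U \<le> card V"
      using less.prems graph distinct_card[of U] card_mono[of V "set U"] by (simp add: simple_graph_def)
    \<comment> \<open>For an isolated \<open>v\<close> the 12 is the sum of 7 for scanning
      \<open>U\<close> and 5 for comparing \<open>v\<close> with itself.\<close>
    have s: "s \<le> 12 * card V + 1 +
      (if nonisolated v then 5 * (card V)\<^sup>2 + 7 * card V else 0)"
    proof (cases "nonisolated v")
      case True
      have "s \<le> length U * (5 * card V + 7) + 1" using split_class_time[OF CR] length_vs by simp
      also have "\<dots> \<le> card V * (5 * card V + 7) + 1" using len by simp
      finally show ?thesis using True by (simp add: power2_eq_square algebra_simps)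
    next
      case False
      then have "\<not> adj v u" for u using adj_nonisolated by blast
      then show ?thesis
        using split_class_time_isolated[OF CR less.prems(3)] v len length_vs False by auto
    qed
    have "num_nonisolated (\<N> @ [C]) \<ge> num_nonisolated \<N> + (if nonisolated v then 1 else 0)"
      using vC by (auto simp: num_nonisolated_def)
    then have "(num_nonisolated \<N> + (if nonisolated v then 1 else 0)) * (5 * (card V)\<^sup>2 + 7 * card V)
      \<le> num_nonisolated (\<N> @ [C]) * (5 * (card V)\<^sup>2 + 7 * card V)"
      by (rule mult_right_mono) simp
    then have "t \<le> 1 + length (\<N> @ [C]) * (12 * card V + 2) +
        num_nonisolated (\<N> @ [C]) * (5 * (card V)\<^sup>2 + 7 * card V)"
      using s t t' by (auto simp: algebra_simps split: if_splits)
    moreover have "class_list U (\<N> @ [C])"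
      using class_list_snoc[OF less.prems(3) v] \<N>(2) C R by simp
    ultimately show ?thesis using \<N>(1) by (intro exI[of _ "\<N> @ [C]"]) simp
  qed
qed

section \<open>Disjointness and number of the classes\<close>

lemma class_list_distinct: "class_list U \<C> \<Longrightarrow> distinct \<C>"
  unfolding class_list_def distinct_concat_iff by (metis removeAll_id)

lemma class_list_disjoint:
  assumes "class_list U \<C>" and "C \<in> set \<C>" "D \<in> set \<C>" and "x \<in> set C" "x \<in> set D"
  shows "C = D"
  using assms by (auto simp: class_list_def distinct_concat_iff)

lemma class_list_length:
  assumes "class_list vs \<C>"
  shows "length (concat \<C>) = card V" and "length \<C> \<le> card V"
proof -
  show *: "length (concat \<C>) = card V"
    using assms distinct_card[of "concat \<C>"] set_vs unfolding class_list_def by metis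
  have "length \<C> \<le> length (concat \<C>)" if "[] \<notin> set \<C>" for \<C> :: "'a list list"
    using that
  proof (induction \<C>)
    case (Cons C \<C>)
    then show ?case by (cases C) auto
  qed simp
  then show "length \<C> \<le> card V" using assms * by (metis class_list_def)
qed

text \<open>One nonisolated vertex \<open>f C\<close> is chosen from each counted class. Chosen
  vertices of different classes are not twins, so \<open>card_nontwins_less\<close> applies to
  them.\<close>

lemma num_nonisolated_less:
  assumes "class_list vs \<C>"
  shows "num_nonisolated \<C> < 2 ^ intersection_number V E"
proof -
  let ?D = "filter (\<lambda>C. \<exists>x\<in>set C. nonisolated x) \<C>"
  have "\<forall>C\<in>set ?D. \<exists>x. x \<in> set C \<and> nonisolated x" by auto
  from bchoice[OF this] obtain f where
    f: "\<And>C. C \<in> set ?D \<Longrightarrow> f C \<in> set C \<and> nonisolated (f C)"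
    by blast
  have cls: "set C = {u \<in> V. twins V E x u}" if "C \<in> set \<C>" "x \<in> set C" for C x
    using assms that set_vs unfolding class_list_def by blast
  have eq: "C = D" if "C \<in> set ?D" "D \<in> set ?D" "twins V E (f C) (f D)" for C D
  proof (rule class_list_disjoint[OF assms])
    show "C \<in> set \<C>" "D \<in> set \<C>" using that by auto
    show "f D \<in> set D" using f that by blast
    then have "f D \<in> V" using cls \<open>D \<in> set \<C>\<close> by blast
    then show "f D \<in> set C" using cls[OF \<open>C \<in> set \<C>\<close>] f[OF that(1)] that(3) by blast
  qed
  have "inj_on f (set ?D)" by (intro inj_onI eq) (simp_all add: twins_refl)
  then have "card (f ` set ?D) = num_nonisolated \<C>"
    using class_list_distinct[OF assms]
    by (simp only: card_image num_nonisolated_def distinct_card distinct_filter)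
  moreover have "card (f ` set ?D) < 2 ^ intersection_number V E"
  proof (rule card_nontwins_less[OF graph])
    show "f ` set ?D \<subseteq> V" using f cls by fastforce
    show "neighbors V E v \<noteq> {}" if "v \<in> f ` set ?D" for v
      using that f unfolding nonisolated_def by blast
    show "u = v" if "u \<in> f ` set ?D" "v \<in> f ` set ?D" "twins V E u v" for u v
      using that eq by blast
  qed
  ultimately show ?thesis by simp
qed

section \<open>Correctness and running time of the algorithm\<close>

definition rep_list :: "'a rep list \<Rightarrow> bool" where
  "rep_list R \<longleftrightarrow> class_list vs (map (snd \<circ> snd) R) \<and>
     (\<forall>(v, k, C) \<in> set R. v \<in> set C \<and> k = length C)"

lemma rep_class:
  assumes "rep_list R" and "(v, k, C) \<in> set R"
  shows "v \<in> set C" and "k = length C" and "\<And>x. x \<in> set C \<Longrightarrow> set C = {u \<in> V. twins V E x u}"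
    and "set C \<subseteq> V"
proof -
  have C: "C \<in> set (map (snd \<circ> snd) R)" using assms(2) by force
  show "v \<in> set C" and "k = length C" using assms by (auto simp: rep_list_def)
  show *: "set C = {u \<in> V. twins V E x u}" if "x \<in> set C" for x
    using assms(1) C that set_vs unfolding rep_list_def class_list_def by blast
  show "set C \<subseteq> V" using * by blast
qed

text \<open>Any vertex of its class determines an entry, as the classes are disjoint and none is
  listed twice. This separates vertices and representatives of different entries.\<close>

lemma rep_list_inj:
  assumes "rep_list R" and "(v, k, C) \<in> set R" "(v', k', C') \<in> set R"
    and "x \<in> set C" "x \<in> set C'"
  shows "(v, k, C) = (v', k', C')"
proof -
  have cl: "class_list vs (map (snd \<circ> snd) R)" using assms(1) by (simp add: rep_list_def)
  have "C = C'"
    by (rule class_list_disjoint[OF cl _ _ assms(4,5)]) (use assms(2,3) in force)+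
  moreover have "inj_on (snd \<circ> snd) (set R)"
    using class_list_distinct[OF cl] by (simp add: distinct_map)
  ultimately show ?thesis
    using assms(2,3) inj_onD[of "snd \<circ> snd" "set R" "(v, k, C)" "(v', k', C')"] by simp
qed

lemma weight_rep_list:
  assumes "rep_list R" and "set S \<subseteq> set R"
  shows "weight S = length (concat (map (snd \<circ> snd) S))"
proof -
  have "fst (snd x) = length (snd (snd x))" if "x \<in> set S" for x
    using that assms rep_class(2)[of R "fst x" "fst (snd x)" "snd (snd x)"] by auto
  then show ?thesis
    unfolding weight_def length_concat by (simp cong: map_cong)
qed

text \<open>Two vertices of one class are twins and hence adjacent; two vertices of different
  classes inherit the edge between the representatives.\<close>

lemma union_of_clique_is_clique:
  assumes R: "rep_list R" and "set S \<subseteq> set R"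
    and S: "sorted_wrt (\<lambda>x y. adj (fst x) (fst y)) S"
  shows "clique V E (set (concat (map (snd \<circ> snd) S)))"
  unfolding clique_def
proof (intro conjI ballI impI)
  show "set (concat (map (snd \<circ> snd) S)) \<subseteq> V"
    using rep_class(4)[OF R] assms(2) by fastforce
next
  fix x y
  assume "x \<in> set (concat (map (snd \<circ> snd) S))" "y \<in> set (concat (map (snd \<circ> snd) S))" "x \<noteq> y"
  then obtain v k C v' k' C' where
    m: "(v, k, C) \<in> set S" "(v', k', C') \<in> set S" and x: "x \<in> set C" and y: "y \<in> set C'"
    by fastforce
  have mR: "(v, k, C) \<in> set R" "(v', k', C') \<in> set R" using m assms(2) by auto
  have V: "x \<in> V" "y \<in> V" "v \<in> V" "v' \<in> V"
    using x y rep_class(1,4)[OF R mR(1)] rep_class(1,4)[OF R mR(2)] by blast+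
  have tw: "twins V E v x" "twins V E v' y"
    using x y rep_class(3)[OF R mR(1) rep_class(1)[OF R mR(1)]]
      rep_class(3)[OF R mR(2) rep_class(1)[OF R mR(2)]] by blast+
  show "{x, y} \<in> E"
  proof (cases "(v, k, C) = (v', k', C')")
    case True
    then have "twins V E x y" using y rep_class(3)[OF R mR(1) x] by simp
    then show ?thesis using \<open>x \<noteq> y\<close> V(1) by (rule twins_imp_edge)
  next
    case False
    \<comment> \<open>\<open>sorted_wrt\<close> relates entries only in the order of their
      positions, which is unknown for the two entries at hand.\<close>
    have "adj a b \<or> adj b a" if "(a, p) \<in> set S" "(b, q) \<in> set S" "(a, p) \<noteq> (b, q)" for a p b q
      using S that by (induction S) auto
    from this[OF m False] have "{v, v'} \<in> E" by (auto simp: insert_commute)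
    then show ?thesis by (intro twins_adjacent[OF tw _ \<open>x \<noteq> y\<close>] V)
  qed
qed

text \<open>Different classes meet \<open>K\<close> in different, hence adjacent vertices, and twins
  pass this edge on to the representatives. The classes that meet \<open>K\<close> cover it, which
  bounds its size. The reversal matches \<open>subset_search_complete\<close>.\<close>

lemma clique_representatives:
  assumes R: "rep_list R" and K: "clique V E K"
  defines "S \<equiv> filter (\<lambda>x. set (snd (snd x)) \<inter> K \<noteq> {}) R"
  shows "sorted_wrt (\<lambda>x y. adj (fst x) (fst y)) (rev S)" and "card K \<le> weight S"
proof -
  have cl: "class_list vs (map (snd \<circ> snd) R)" using R by (simp add: rep_list_def)
  have adj: "adj (fst p) (fst q)" if pq: "p \<in> set S" "q \<in> set S" "p \<noteq> q" for p q
  proof -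
    obtain v k C v' k' C' where eq: "p = (v, k, C)" "q = (v', k', C')" by (metis prod_cases3)
    have mR: "(v, k, C) \<in> set R" "(v', k', C') \<in> set R" using pq eq by (auto simp: S_def)
    obtain x y where x: "x \<in> set C" "x \<in> K" and y: "y \<in> set C'" "y \<in> K"
      using pq eq by (auto simp: S_def)
    have "x \<noteq> y" "v \<noteq> v'"
      using rep_list_inj[OF R mR] x y pq(3) eq rep_class(1)[OF R mR(1)] rep_class(1)[OF R mR(2)]
      by auto
    have "{x, y} \<in> E" using K x y \<open>x \<noteq> y\<close> by (auto simp: clique_def)
    moreover have "x \<in> V" "y \<in> V" "v \<in> V" "v' \<in> V"
      using x y rep_class(1,4)[OF R mR(1)] rep_class(1,4)[OF R mR(2)] by blast+
    moreover have "twins V E x v" "twins V E y v'"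
      using rep_class(1)[OF R mR(1)] rep_class(1)[OF R mR(2)]
        rep_class(3)[OF R mR(1) x(1)] rep_class(3)[OF R mR(2) y(1)] by blast+
    ultimately have "{v, v'} \<in> E" using \<open>v \<noteq> v'\<close> by (intro twins_adjacent[of V E x v y v'])
    then show ?thesis by (simp add: eq)
  qed
  have "distinct R" using class_list_distinct[OF cl] by (simp add: distinct_map)
  then have "distinct (rev S)" by (simp add: S_def)
  then show "sorted_wrt (\<lambda>x y. adj (fst x) (fst y)) (rev S)"
    using adj by (intro sorted_wrt_if_distinct) auto
  have "K \<subseteq> set (concat (map (snd \<circ> snd) R))"
    using K cl set_vs unfolding class_list_def clique_def by blast
  then have "K \<subseteq> set (concat (map (snd \<circ> snd) S))" by (fastforce simp: S_def)
  then have "card K \<le> card (set (concat (map (snd \<circ> snd) S)))" by (intro card_mono) simp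
  also have "\<dots> \<le> length (concat (map (snd \<circ> snd) S))" by (rule card_length)
  also have "\<dots> = weight S" by (rule weight_rep_list[OF R, symmetric]) (simp add: S_def)
  finally show "card K \<le> weight S" .
qed

lemma subset_search_correct:
  assumes R: "rep_list R" and run: "(r, t) \<in> runs (subset_search skip adj [] R)"
  obtains k S where "r = Some (k, S)" and "maximum_clique V E (set (concat (map (snd \<circ> snd) S)))"
    and "length S \<le> length R" and "length (concat (map (snd \<circ> snd) S)) \<le> card V"
proof -
  have cl: "class_list vs (map (snd \<circ> snd) R)" using R by (simp add: rep_list_def)
  have sym: "symp adj" by (auto simp: symp_def insert_commute)
  \<comment> \<open>The empty sublist is a clique, so the result is not \<open>None\<close>.\<close>
  obtain k S where r: "r = Some (k, S)"
    using subset_search_complete[OF run sym, of "[]"] by auto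
  obtain zs where zs: "subseq zs R" "S = rev zs"
    and S: "sorted_wrt (\<lambda>x y. adj (fst x) (fst y)) S" and k: "k = weight S"
    using subset_search_sound[OF run r] by auto
  have sub: "set S \<subseteq> set R" using zs set_subseq_subset by auto
  let ?Q = "concat (map (snd \<circ> snd) S)"
  have "distinct (map (snd \<circ> snd) zs)"
    using class_list_distinct[OF cl] by (rule distinct_subseq[OF subseq_map[OF zs(1)]])
  then have "distinct (map (snd \<circ> snd) S)" unfolding zs(2) by (simp add: distinct_map)
  moreover have "set (map (snd \<circ> snd) S) \<subseteq> set (map (snd \<circ> snd) R)" using sub by auto
  \<comment> \<open>Disjoint classes, each taken at most once: the sum of the sizes is the size of
    the union.\<close>
  ultimately have dist: "distinct ?Q"
    using cl unfolding class_list_def distinct_concat_iff by (meson distinct_removeAll subsetD)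
  have clq: "clique V E (set ?Q)" using union_of_clique_is_clique[OF R sub S] .
  have card: "card (set ?Q) = k" using dist k weight_rep_list[OF R sub] distinct_card by metis
  have "card K \<le> k" if "clique V E K" for K
  proof -
    define T where "T = filter (\<lambda>x. set (snd (snd x)) \<inter> K \<noteq> {}) R"
    have T: "sorted_wrt (\<lambda>x y. adj (fst x) (fst y)) (rev T)" "card K \<le> weight T"
      using clique_representatives[OF R that] by (auto simp: T_def)
    have "weight (rev T) \<le> k"
      using subset_search_complete[OF run sym, of T] T(1) r by (auto simp: T_def)
    moreover have "weight (rev T) = weight T" by (simp add: weight_def flip: rev_map)
    ultimately show ?thesis using T(2) by simp
  qed
  then have "maximum_clique V E (set ?Q)" using clq card by (simp add: maximum_clique_def)
  moreover have "length S \<le> length R" using zs by (simp add: list_emb_length)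
  moreover have "length ?Q \<le> card V"
    using clq graph card_mono[of V "set ?Q"] unfolding distinct_card[OF dist]
    by (simp only: clique_def simple_graph_def)
  ultimately show ?thesis using that r by blast
qed

text \<open>The number \<open>?p\<close> of nonisolated representatives is below
  \<open>2 ^ m\<close>. The polynomial factor \<open>(?p + 1)\<^sup>2\<close> is thus at most
  \<open>2 ^ (2 * m)\<close>, the source of the linear term in the exponent. Without
  \<open>skip\<close>, all representatives are nonisolated by assumption and the general bound
  suffices.\<close>

lemma subset_search_reps_time:
  assumes R: "rep_list R" and run: "(r, t) \<in> runs (subset_search skip adj [] R)"
    and "skip \<or> no_isolated_vertex V E"
  defines "m \<equiv> intersection_number V E"
  shows "t \<le> card V * (2 * card V + 7) + 5 * 2 ^ (2 ^ m + 2 * m)"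
proof -
  let ?p = "length (filter (\<lambda>x. nonisolated (fst x)) R)"
  have cl: "class_list vs (map (snd \<circ> snd) R)" using R by (simp add: rep_list_def)
  have "?p \<le> num_nonisolated (map (snd \<circ> snd) R)"
  proof -
    have "\<forall>(v, k, C) \<in> set R. v \<in> set C" using R by (auto simp: rep_list_def)
    then show ?thesis unfolding num_nonisolated_def
      by (induction R) (auto split: if_splits)
  qed
  then have p: "?p + 1 \<le> 2 ^ m" using num_nonisolated_less[OF cl] by (simp add: m_def)
  have len: "length R \<le> card V" using class_list_length(2)[OF cl] by simp
  have "t \<le> length R * (2 * card V + 7) + 2 ^ ?p * (5 * (?p + 1)\<^sup>2)"
  proof (cases skip)
    case True
    with run have "(r, t) \<in> runs (subset_search True adj [] R)" by simp
    from subset_search_time_skip[OF this adj_nonisolated le_refl len] show ?thesis .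
  next
    case False
    then have "nonisolated (fst x)" if "x \<in> set R" for x
      using that assms(3) rep_class(1,4)[OF R, of "fst x" "fst (snd x)" "snd (snd x)"]
      by (auto simp: no_isolated_vertex_def nonisolated_def)
    then have "filter (\<lambda>x. nonisolated (fst x)) R = R" by simp
    then show ?thesis using subset_search_time[OF run, of "length R"] by simp
  qed
  also have "\<dots> \<le> card V * (2 * card V + 7) + 2 ^ (2 ^ m) * (5 * (2 ^ m)\<^sup>2)"
    using len p by (intro add_mono mult_mono power_increasing power_mono) auto
  also have "2 ^ (2 ^ m) * (5 * (2 ^ m)\<^sup>2) = (5 * 2 ^ (2 ^ m + 2 * m) :: nat)"
    by (simp add: power_add power_mult mult.commute flip: power_mult)
  finally show ?thesis .
qed

section \<open>The complete algorithm\<close>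

lemma rep_list_of_run:
  assumes "class_list vs \<C>" and "(R, t) \<in> runs (representatives \<C>)"
  shows "rep_list R"
  using assms representatives_run[OF assms(2)] by (simp add: rep_list_def)

text \<open>Picks are made from a nonempty list of remaining vertices or from a class, and no class
  is empty.\<close>

lemma has_run_find_max_clique: "has_run (find_max_clique skip adj vs)"
  unfolding find_max_clique_def
proof (intro has_run_bind has_run_collect_classes has_run_subset_search)
  fix \<C> s
  assume "(\<C>, s) \<in> runs (collect_classes adj vs vs [])"
  then have "class_list vs \<C>"
    using collect_classes_run[of \<C> s vs "[]"] distinct_vs set_vs by auto
  then show "has_run (representatives \<C>)"
    by (intro has_run_representatives) (simp add: class_list_def)
qed (simp split: option.split)

lemma find_max_clique_run:
  assumes "(Q, t) \<in> runs (find_max_clique skip adj vs)"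
  defines "m \<equiv> intersection_number V E" and "n \<equiv> card V"
  shows "maximum_clique V E (set Q)"
    and "skip \<or> no_isolated_vertex V E \<Longrightarrow>
      t \<le> 50 * (2 ^ (2 ^ m + 2 * m) + n\<^sup>2 * min (2 ^ m) n)"
proof -
  from assms(1) obtain \<C> t1 R t2 r t3 t4 where
    \<C>: "(\<C>, t1) \<in> runs (collect_classes adj vs vs [])"
    and R: "(R, t2) \<in> runs (representatives \<C>)"
    and r: "(r, t3) \<in> runs (subset_search skip adj [] R)"
    and Q: "(Q, t4) \<in> runs (case r of None \<Rightarrow> step [] | Some (_, S) \<Rightarrow> union_classes S)"
    and t: "t = t1 + t2 + t3 + t4"
    by (auto simp: find_max_clique_def add.assoc)
  have cl: "class_list vs \<C>"
    and t1: "t1 \<le> 1 + length \<C> * (12 * n + 2) + num_nonisolated \<C> * (5 * n\<^sup>2 + 7 * n)"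
    using collect_classes_run[OF \<C>] distinct_vs set_vs by (auto simp: n_def)
  have rl: "rep_list R" using rep_list_of_run[OF cl R] .
  have len: "length \<C> \<le> n" "length (concat \<C>) = n"
    using class_list_length[OF cl] by (simp_all add: n_def)
  have lenR: "length R \<le> n" using representatives_run[OF R] len by (metis length_map)
  obtain k S where S: "r = Some (k, S)"
    "maximum_clique V E (set (concat (map (snd \<circ> snd) S)))"
    "length S \<le> length R" "length (concat (map (snd \<circ> snd) S)) \<le> n"
    using subset_search_correct[OF rl r] n_def by metis
  have Q': "Q = concat (map (snd \<circ> snd) S)" and t4: "t4 \<le> 2 * n + 1"
    using Q S lenR by (auto simp: union_classes_run)
  show "maximum_clique V E (set Q)" using S(2) Q' by simp
  assume "skip \<or> no_isolated_vertex V E"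
  then have t3: "t3 \<le> n * (2 * n + 7) + 5 * 2 ^ (2 ^ m + 2 * m)"
    using subset_search_reps_time[OF rl r] by (simp add: n_def m_def)
  have t2: "t2 \<le> 4 * n + 1" using representatives_run[OF R] len by simp
  let ?M = "n\<^sup>2 * min (2 ^ m) n" and ?q = "num_nonisolated \<C>"
  have sq: "n \<le> n\<^sup>2" by (simp add: power2_eq_square)
  have M: "n\<^sup>2 \<le> ?M" by (cases "n = 0") auto
  have "?q \<le> length \<C>" by (simp add: num_nonisolated_def)
  \<comment> \<open>Both bounds on the number of expensive rounds enter here: at most one class per
    vertex, and fewer than \<open>2 ^ m\<close> nonisolated classes.\<close>
  then have "?q \<le> min (2 ^ m) n" using num_nonisolated_less[OF cl] len by (simp add: m_def)
  then have "?q * (5 * n\<^sup>2 + 7 * n) \<le> min (2 ^ m) n * (12 * n\<^sup>2)"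
    using sq by (intro mult_mono) auto
  then have q: "?q * (5 * n\<^sup>2 + 7 * n) \<le> 12 * ?M" by (simp add: mult.commute mult.left_commute)
  have "length \<C> * (12 * n + 2) \<le> n * (12 * n + 2)"
    using len(1) by (rule mult_right_mono) simp
  also have "\<dots> = 12 * n\<^sup>2 + 2 * n" by (simp add: power2_eq_square algebra_simps)
  finally have c: "length \<C> * (12 * n + 2) \<le> 14 * n\<^sup>2" using sq by linarith
  have "n * (2 * n + 7) = 2 * n\<^sup>2 + 7 * n" by (simp add: power2_eq_square algebra_simps)
  then have s: "n * (2 * n + 7) \<le> 9 * n\<^sup>2" using sq by linarith
  define X M :: nat where "X = 2 ^ (2 ^ m + 2 * m)" and "M = ?M"
  have "t1 \<le> 1 + 14 * n\<^sup>2 + 12 * M"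
    using t1 c q unfolding M_def by (meson add_mono le_refl le_trans)
  moreover have "t3 \<le> 9 * n\<^sup>2 + 5 * X"
    using t3 s unfolding X_def by (meson add_mono le_refl le_trans)
  moreover have "n\<^sup>2 \<le> M" "1 \<le> X" using M by (simp_all add: M_def X_def)
  moreover from this(1) have "n \<le> M" using sq by (rule le_trans[rotated])
  \<comment> \<open>All terms in \<open>n\<close> and \<open>n\<^sup>2\<close> go into
    \<open>M\<close> and the constants into \<open>X\<close>, for a total of
    \<open>8 * X + 41 * M\<close>; 50 is a round bound.\<close>
  ultimately have "t \<le> 50 * X + 50 * M" using t t2 t4 by linarith
  then show "t \<le> 50 * (2 ^ (2 ^ m + 2 * m) + ?M)"
    by (simp only: X_def M_def add_mult_distrib2)
qed

end

theorem theorem2: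
  shows "\<exists>A c :: nat. \<forall>(V :: 'a set) E vs n m skip.
    simple_graph V E \<and> card V = n \<and> intersection_number V E = m \<and>
    distinct vs \<and> set vs = V \<longrightarrow>
      runs (find_max_clique skip (\<lambda>u v. {u, v} \<in> E) vs) \<noteq> {} \<and>
      (\<forall>(Q, t) \<in> runs (find_max_clique skip (\<lambda>u v. {u, v} \<in> E) vs).
         maximum_clique V E (set Q) \<and>
         (skip \<or> no_isolated_vertex V E \<longrightarrow>
            t \<le> A * (2 ^ (2 ^ m + c * m) + n\<^sup>2 * min (2 ^ m) n)))"
\<comment> \<open>The witnesses, 50 for \<open>A\<close> and 2 for \<open>c\<close>, are supplied by
  the final \<open>show\<close>.\<close>
proof (intro exI allI impI)
  fix V :: "'a set" and E vs n m skip
  assume *: "simple_graph V E \<and> card V = n \<and> intersection_number V E = m \<and>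
    distinct vs \<and> set vs = V"
  then interpret listed_graph V E vs by unfold_locales auto
  show "runs (find_max_clique skip (\<lambda>u v. {u, v} \<in> E) vs) \<noteq> {} \<and>
      (\<forall>(Q, t) \<in> runs (find_max_clique skip (\<lambda>u v. {u, v} \<in> E) vs).
         maximum_clique V E (set Q) \<and>
         (skip \<or> no_isolated_vertex V E \<longrightarrow>
            t \<le> 50 * (2 ^ (2 ^ m + 2 * m) + n\<^sup>2 * min (2 ^ m) n)))"
    using has_run_find_max_clique find_max_clique_run * unfolding has_run_def by auto
qed

end
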